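(* Let $n\ge 2$ and $s\ge 3$ be integers, let $A$ be a unital algebra over a commutative unital ring $\mathcal{R}$, and let $\mathcal{A}=M_s(A)$ be the full matrix algebra of $s\times s$ matrices over $A$. Suppose that $\mathcal{A}$ is $2$- and $(n-1)$-torsion free. Then every Lie $n$-derivation on $M_s(A)$ is standard.
   Context: Linear means $\mathcal{R}$-linear; $\mathcal{Z}(\mathcal{A})$ is the centre of $\mathcal{A}$. For a positive integer $k$, $\mathcal{A}$ is $k$-torsion free if $kx=0$ implies $x=0$ for each $x\in\mathcal{A}$. $[x,y]=xy-yx$. Define $p_1(x_1)=x_1$ and $p_n(x_1,\dots,x_n)=[p_{n-1}(x_1,\dots,x_{n-1}),x_n]$ for $n\ge2$; for $n\ge 2$, $p_n(x_1,\dots,x_n)$ is called an $(n-1)$-th commutator. A linear map $\varphi:\mathcal{A}\to\mathcal{A}$ is a Lie $n$-derivation if $\varphi(p_n(x_1,\dots,x_n))=\sum_{i=1}^n p_n(x_1,\dots,x_{i-1},\varphi(x_i),x_{i+1},\dots,x_n)$ for all $x_1,\dots,x_n\in\mathcal{A}$. A Lie $n$-derivation is standard if it equals $h+\tau$ with $h$ a derivation on $\mathcal{A}$ (linear, $h(xy)=h(x)y+xh(y)$) and $\tau$ a linear mapping from $\mathcal{A}$ into $\mathcal{Z}(\mathcal{A})$ vanishing on all $(n-1)$-th commutators of $\mathcal{A}$. *)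

theory Defs
  imports "HOL-Analysis.Finite_Cartesian_Product" "HOL-Analysis.Cartesian_Space"
begin

locale unital_algebra = module smul
  for smul :: "'r::comm_ring_1 \<Rightarrow> 'a::ring_1 \<Rightarrow> 'a" +
  assumes smul_mult_left: "smul r x * y = smul r (x * y)"
    and smul_mult_right: "x * smul r y = smul r (x * y)"

text \<open>
  Below, an algebra is given by its scalar action \<open>smul\<close> and its product \<open>mul\<close> on an additive
  group. The product is an explicit argument because the type-class product on \<open>'a^'s^'s\<close> is
  componentwise; the algebra of matrices uses \<open>(**)\<close>.
\<close>

definition mat_smul :: "('r \<Rightarrow> 'a \<Rightarrow> 'a) \<Rightarrow> 'r \<Rightarrow> 'a^'n^'m \<Rightarrow> 'a^'n^'m"
  where "mat_smul smul r X = map_matrix (smul r) X"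

lemma (in unital_algebra) module_mat_smul:
  "module (mat_smul smul :: 'r \<Rightarrow> 'a^'n^'m \<Rightarrow> 'a^'n^'m)"
  by unfold_locales
    (simp_all add: mat_smul_def map_matrix_def vec_eq_iff scale_right_distrib scale_left_distrib)

definition torsion_free :: "nat \<Rightarrow> 'b::comm_monoid_add set \<Rightarrow> bool"
  where "torsion_free k A \<longleftrightarrow> (\<forall>x\<in>A. (\<Sum>_<k. x) = 0 \<longrightarrow> x = 0)"

definition lie_bracket :: "('b \<Rightarrow> 'b \<Rightarrow> 'b) \<Rightarrow> 'b \<Rightarrow> 'b \<Rightarrow> 'b::ab_group_add"
  where "lie_bracket mul x y = mul x y - mul y x"

text \<open>
  \<open>lie_poly mul n x\<close> is the iterated bracket \<open>[\<dots>[[x 1, x 2], x 3], \<dots>, x n]\<close>, where the arguments are given by a sequence \<open>x\<close>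
  of which only the entries with index \<open>1, \<dots>, n\<close> matter. The value at \<open>n = 0\<close> is a dummy.
\<close>

fun lie_poly :: "('b \<Rightarrow> 'b \<Rightarrow> 'b) \<Rightarrow> nat \<Rightarrow> (nat \<Rightarrow> 'b) \<Rightarrow> 'b::ab_group_add"
  where
    "lie_poly mul 0 x = 0"
  | "lie_poly mul (Suc 0) x = x 1"
  | "lie_poly mul (Suc (Suc n)) x = lie_bracket mul (lie_poly mul (Suc n) x) (x (Suc (Suc n)))"

definition centre :: "('b \<Rightarrow> 'b \<Rightarrow> 'b) \<Rightarrow> 'b set"
  where "centre mul = {z. \<forall>x. mul z x = mul x z}"

definition lie_n_derivation ::
  "('r::comm_ring_1 \<Rightarrow> 'b \<Rightarrow> 'b) \<Rightarrow> ('b \<Rightarrow> 'b \<Rightarrow> 'b) \<Rightarrow> nat \<Rightarrow> ('b \<Rightarrow> 'b::ab_group_add) \<Rightarrow> bool"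
  where "lie_n_derivation smul mul n \<phi> \<longleftrightarrow>
    module_hom smul smul \<phi> \<and>
    (\<forall>x. \<phi> (lie_poly mul n x) = (\<Sum>i=1..n. lie_poly mul n (x(i := \<phi> (x i)))))"

definition algebra_derivation ::
  "('r::comm_ring_1 \<Rightarrow> 'b \<Rightarrow> 'b) \<Rightarrow> ('b \<Rightarrow> 'b \<Rightarrow> 'b) \<Rightarrow> ('b \<Rightarrow> 'b::ab_group_add) \<Rightarrow> bool"
  where "algebra_derivation smul mul h \<longleftrightarrow>
    module_hom smul smul h \<and> (\<forall>x y. h (mul x y) = mul (h x) y + mul x (h y))"

definition standard_lie_n_derivation ::
  "('r::comm_ring_1 \<Rightarrow> 'b \<Rightarrow> 'b) \<Rightarrow> ('b \<Rightarrow> 'b \<Rightarrow> 'b) \<Rightarrow> nat \<Rightarrow> ('b \<Rightarrow> 'b::ab_group_add) \<Rightarrow> bool"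
  where "standard_lie_n_derivation smul mul n \<phi> \<longleftrightarrow>
    lie_n_derivation smul mul n \<phi> \<and>
    (\<exists>h \<tau>. \<phi> = (\<lambda>x. h x + \<tau> x) \<and> algebra_derivation smul mul h \<and>
      module_hom smul smul \<tau> \<and> range \<tau> \<subseteq> centre mul \<and> (\<forall>x. \<tau> (lie_poly mul n x) = 0))"

end

theory Submission
  imports Defs
begin

text \<open>
  Write \<open>e\<^sub>k\<close> for the diagonal matrix units \<open>E k k 1\<close>. Bracketing with \<open>e\<^sub>j\<close> on the right fixes every
  multiple \<open>E i j a\<close> of an off-diagonal unit in column \<open>j\<close>, so filling the last \<open>n - 2\<close> arguments of
  the \<open>n\<close>-fold bracket with \<open>e\<^sub>j\<close> turns it into a plain bracket \<open>[u, v]\<close> as soon as \<open>[u, v]\<close> has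
  the form \<open>E i j a\<close> with \<open>i \<noteq> j\<close>. Every piece of information about a Lie \<open>n\<close>-derivation \<open>\<phi>\<close> is extracted
  from such arguments, or from padded pairs with \<open>[u, v] = 0\<close>; the proof is thereby uniform in \<open>n\<close>.

  The map is normalised first. Brackets of the \<open>e\<^sub>k\<close> with each other show that the off-diagonal
  parts of the matrices \<open>\<phi> e\<^sub>k\<close> fit together to one matrix \<open>M\<close> with \<open>[e\<^sub>k, M]\<close> equal to the off-diagonal
  part of \<open>\<phi> e\<^sub>k\<close> for all \<open>k\<close> (\<open>idempotent_nth\<close>). Subtracting the inner derivation \<open>X \<mapsto> [X, M]\<close>
  leaves a Lie \<open>n\<close>-derivation \<open>\<psi>\<close> with diagonal values on the \<open>e\<^sub>k\<close>. If \<open>e\<^sub>k\<close> stands in \<open>n - 1\<close>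
  positions, the identity for \<open>\<psi>\<close> reads \<open>(n - 1) [E i k a, \<psi> e\<^sub>k] = 0\<close> in entry \<open>(i, k)\<close>. As the
  algebra is \<open>(n - 1)\<close>-torsion free, \<open>\<psi> e\<^sub>k\<close> is central (\<open>idempotent_centre\<close>).

  From then on the padding by the \<open>e\<^sub>j\<close> costs nothing: terms in which \<open>\<psi>\<close> hits an \<open>e\<^sub>j\<close> vanish. So \<open>\<psi>\<close>
  maps \<open>E i j a\<close> to some \<open>E i j b\<close> for \<open>i \<noteq> j\<close> (\<open>off_diagonal_support\<close>), and it maps \<open>E i i a\<close> to a
  diagonal matrix all of whose entries outside position \<open>i\<close> are one and the same central element
  (\<open>diagonal_other_entries\<close>). Both facts rest on an index \<open>k\<close> different from \<open>i\<close> and \<open>j\<close>, hence on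
  \<open>s \<ge> 3\<close>. Subtracting this scalar matrix on the diagonal units leaves a map \<open>der\<close> that acts entry
  by entry, through functions \<open>coeff i j\<close> on the coefficient ring, and \<open>coeff_product\<close> says precisely
  that \<open>der\<close> is a derivation. The difference \<open>\<psi> - der\<close> is a Lie \<open>n\<close>-derivation with central values, and
  such a map kills \<open>n\<close>-fold brackets because a central argument makes every bracket vanish. Adding the
  inner derivation back to \<open>der\<close> gives the standard form of \<open>\<phi>\<close>.
\<close>

section \<open>Iterated brackets in a matrix algebra\<close>

abbreviation lie :: "'a::ring_1^'s^'s \<Rightarrow> 'a^'s^'s \<Rightarrow> 'a^'s^'s"
  where "lie \<equiv> lie_bracket (**)"

lemma matrix_mult_nth: "(X ** Y) $ p $ q = (\<Sum>k\<in>UNIV. X $ p $ k * Y $ k $ q)"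
  by (simp add: matrix_matrix_mult_def)

lemma matrix_sub_ldistrib: "(A::'a::ring_1^'n^'m) ** (B - C) = A ** B - A ** C"
  by (simp add: vec_eq_iff matrix_mult_nth algebra_simps sum_subtractf)

lemma matrix_sub_rdistrib: "((A::'a::ring_1^'n^'m) - B) ** C = A ** C - B ** C"
  by (simp add: vec_eq_iff matrix_mult_nth algebra_simps sum_subtractf)

lemma matrix_add_rdistrib: "((A::'a::ring_1^'n^'m) + B) ** C = A ** C + B ** C"
  by (simp add: vec_eq_iff matrix_mult_nth algebra_simps sum.distrib)

lemma lie_add_left: "lie (X + Y) Z = lie X Z + lie Y Z"
  by (simp add: lie_bracket_def matrix_add_ldistrib matrix_add_rdistrib)

lemma lie_diff_right: "lie X (Y - Z) = lie X Y - lie X Z"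
  by (simp add: lie_bracket_def matrix_sub_ldistrib matrix_sub_rdistrib)

lemma lie_diff_left: "lie (X - Y) Z = lie X Z - lie Y Z"
  by (simp add: lie_bracket_def matrix_sub_ldistrib matrix_sub_rdistrib)

lemma lie_zero [simp]: "lie 0 X = 0" "lie X 0 = 0"
  by (simp_all add: lie_bracket_def)

lemma lie_sum_left: "lie (\<Sum>i\<in>I. f i) Z = (\<Sum>i\<in>I. lie (f i) Z)"
  by (induction I rule: infinite_finite_induct) (simp_all add: lie_add_left)

lemma lie_centre: "Z \<in> centre (**) \<Longrightarrow> lie X Z = 0" "Z \<in> centre (**) \<Longrightarrow> lie Z X = 0"
  by (simp_all add: lie_bracket_def centre_def)

lemma lie_poly_cong:
  "(\<And>j. 1 \<le> j \<Longrightarrow> j \<le> n \<Longrightarrow> x j = y j) \<Longrightarrow> lie_poly mul n x = lie_poly mul n y"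
  by (induction mul n x rule: lie_poly.induct) auto

text \<open>
  The Leibniz sum over the argument positions, split into the last position and the others, obeys the
  recursion of the iterated bracket itself; this drives all inductions on the number of arguments.
\<close>

lemma lie_poly_update_sum:
  fixes f :: "'a::ring_1^'s^'s \<Rightarrow> 'a^'s^'s"
  shows "(\<Sum>i=1..Suc (Suc m). lie_poly (**) (Suc (Suc m)) (x(i := f (x i))))
    = lie (\<Sum>i=1..Suc m. lie_poly (**) (Suc m) (x(i := f (x i)))) (x (Suc (Suc m)))
      + lie (lie_poly (**) (Suc m) x) (f (x (Suc (Suc m))))"
proof -
  have "(\<Sum>i=1..Suc m. lie_poly (**) (Suc (Suc m)) (x(i := f (x i))))
      = (\<Sum>i=1..Suc m. lie (lie_poly (**) (Suc m) (x(i := f (x i)))) (x (Suc (Suc m))))"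
    by (rule sum.cong) auto
  moreover have "lie_poly (**) (Suc m) (x(Suc (Suc m) := f (x (Suc (Suc m))))) = lie_poly (**) (Suc m) x"
    by (rule lie_poly_cong) auto
  ultimately show ?thesis
    unfolding lie_sum_left by (subst sum.cl_ivl_Suc) simp
qed

lemma lie_poly_derivation:
  fixes d :: "'a::ring_1^'s^'s \<Rightarrow> 'a^'s^'s"
  assumes d: "\<And>X Y. d (lie X Y) = lie (d X) Y + lie X (d Y)"
  shows "d (lie_poly (**) (Suc m) x) = (\<Sum>i=1..Suc m. lie_poly (**) (Suc m) (x(i := d (x i))))"
proof (induction m)
  case 0
  show ?case by simp
next
  case (Suc m)
  show ?case unfolding lie_poly_update_sum Suc[symmetric] by (simp add: d)
qed

lemma lie_poly_update_diff:
  fixes x :: "nat \<Rightarrow> 'a::ring_1^'s^'s"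
  assumes "i \<in> {1..Suc m}"
  shows "lie_poly (**) (Suc m) (x(i := a - b))
    = lie_poly (**) (Suc m) (x(i := a)) - lie_poly (**) (Suc m) (x(i := b))"
  using assms
proof (induction m)
  case 0
  then show ?case by simp
next
  case (Suc m)
  show ?case
  proof (cases "i = Suc (Suc m)")
    case True
    have "lie_poly (**) (Suc m) (x(i := c)) = lie_poly (**) (Suc m) x" for c
      by (rule lie_poly_cong) (simp add: True)
    then show ?thesis
      by (simp only: True lie_poly.simps fun_upd_same lie_diff_right)
  next
    case False
    then show ?thesis using Suc by (simp add: lie_diff_left)
  qed
qed

lemma lie_poly_centre:
  fixes x :: "nat \<Rightarrow> 'a::ring_1^'s^'s"
  assumes "i \<in> {1..Suc (Suc m)}" and "x i \<in> centre (**)"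
  shows "lie_poly (**) (Suc (Suc m)) x = 0"
  using assms(1)
proof (induction m)
  case 0
  then have "i = 1 \<or> i = 2" by auto
  then show ?case using assms(2) by (auto simp: lie_centre numeral_2_eq_2)
next
  case (Suc m)
  then show ?case using assms(2)
    by (cases "i = Suc (Suc (Suc m))") (simp_all add: lie_centre)
qed

section \<open>Bracketing repeatedly with one element\<close>

abbreviation ad_pow :: "'a::ring_1^'s^'s \<Rightarrow> nat \<Rightarrow> 'a^'s^'s \<Rightarrow> 'a^'s^'s"
  where "ad_pow e m \<equiv> (\<lambda>X. lie X e) ^^ m"

text \<open>
  Positions count from 1, as in \<open>lie_poly\<close>; the value at 0 is a dummy.
\<close>

definition pad :: "'b \<Rightarrow> 'b \<Rightarrow> 'b \<Rightarrow> nat \<Rightarrow> 'b"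
  where "pad u v e = (\<lambda>j. if j = 1 then u else if j = 2 then v else e)"

lemma lie_poly_pad: "lie_poly (**) (Suc (Suc m)) (pad u v e) = ad_pow e m (lie u v)"
  by (induction m) (simp_all add: pad_def)

text \<open>
  The brackets with \<open>e\<close> before and after \<open>f e\<close> act trivially, so the \<open>m\<close> terms in which \<open>f e\<close> replaces an
  entry of the padding coincide. Repeated terms of this kind are what torsion freeness is applied to.
\<close>

lemma lie_poly_pad_sum:
  assumes fix_e: "lie (lie u v) e = lie u v"
    and fix_d: "lie (lie (lie u v) (f e)) e = lie (lie u v) (f e)"
  shows "(\<Sum>i=1..Suc (Suc m). lie_poly (**) (Suc (Suc m)) ((pad u v e)(i := f (pad u v e i))))
    = ad_pow e m (lie (f u) v + lie u (f v)) + (\<Sum>_<m. lie (lie u v) (f e))"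
proof (induction m)
  case 0
  show ?case by (simp add: pad_def)
next
  case (Suc m)
  have "ad_pow e m (lie u v) = lie u v"
    using fix_e by (induction m) auto
  then show ?case
    unfolding lie_poly_update_sum[of "Suc m"] Suc lie_poly_pad
    by (simp add: pad_def lie_add_left lie_sum_left fix_d add.assoc del: sum_constant)
qed

section \<open>Matrix units\<close>

definition E :: "'s \<Rightarrow> 's \<Rightarrow> 'a::ring_1 \<Rightarrow> 'a^'s^'s"
  where "E i j a = (\<chi> p q. if p = i \<and> q = j then a else 0)"

lemma E_nth [simp]: "E i j a $ p $ q = (if p = i \<and> q = j then a else 0)"
  by (simp add: E_def)

lemma E_mult_nth: "(E i j a ** M) $ p $ q = (if p = i then a * M $ j $ q else 0)"
proof -
  have "(E i j a ** M) $ p $ q = (\<Sum>k\<in>UNIV. if k = j then (if p = i then a * M $ j $ q else 0) else 0)"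
    unfolding matrix_mult_nth by (rule sum.cong) auto
  then show ?thesis by simp
qed

lemma mult_E_nth: "(M ** E i j a) $ p $ q = (if q = j then M $ p $ i * a else 0)"
proof -
  have "(M ** E i j a) $ p $ q = (\<Sum>k\<in>UNIV. if k = i then (if q = j then M $ p $ i * a else 0) else 0)"
    unfolding matrix_mult_nth by (rule sum.cong) auto
  then show ?thesis by simp
qed

lemma lie_E_right_nth: "lie M (E i j a) $ p $ q
    = (if q = j then M $ p $ i * a else 0) - (if p = i then a * M $ j $ q else 0)"
  by (simp add: lie_bracket_def E_mult_nth mult_E_nth)

lemma lie_E_left_nth: "lie (E i j a) M $ p $ q
    = (if p = i then a * M $ j $ q else 0) - (if q = j then M $ p $ i * a else 0)"
  by (simp add: lie_bracket_def E_mult_nth mult_E_nth)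

lemma lie_E_E: "lie (E i j a) (E k l b)
    = (if j = k then E i l (a * b) else 0) - (if i = l then E k j (b * a) else 0)"
  by (auto simp: vec_eq_iff lie_E_left_nth)

lemma E_zero [simp]: "E i j 0 = 0"
  by (simp add: vec_eq_iff)

lemma E_add: "E i j (a + b) = E i j a + E i j b"
  by (simp add: vec_eq_iff)

lemma E_sum: "X = (\<Sum>i\<in>UNIV. \<Sum>j\<in>UNIV. E i j (X $ i $ j))"
proof -
  have "(\<Sum>i\<in>UNIV. \<Sum>j\<in>UNIV. if p = i \<and> q = j then X $ i $ j else 0) = X $ p $ q" for p q
  proof -
    have "(\<Sum>i\<in>UNIV. \<Sum>j\<in>UNIV. if p = i \<and> q = j then X $ i $ j else 0)
      = (\<Sum>i\<in>UNIV. if p = i then \<Sum>j\<in>UNIV. if q = j then X $ i $ j else 0 else 0)"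
      by (rule sum.cong) auto
    then show ?thesis by simp
  qed
  then show ?thesis by (simp add: vec_eq_iff)
qed

text \<open>
  Bracketing with a diagonal unit acts on each matrix entry separately, with weight \<open>1\<close>, \<open>-1\<close> or \<open>0\<close>.
\<close>

lemma ad_pow_row_nth: "p \<noteq> q \<Longrightarrow> ad_pow (E p p 1) m X $ p $ q = (-1) ^ m * X $ p $ q"
  by (induction m) (simp_all add: lie_E_right_nth)

lemma ad_pow_col_nth: "p \<noteq> q \<Longrightarrow> ad_pow (E q q 1) m X $ p $ q = X $ p $ q"
  by (induction m) (simp_all add: lie_E_right_nth)

lemma ad_pow_nth_zero: "X $ p $ q = 0 \<Longrightarrow> ad_pow (E k k 1) m X $ p $ q = 0"
  by (induction m) (auto simp: lie_E_right_nth)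

lemma scalar_in_centre:
  fixes Z :: "'a::ring_1^'s^'s"
  assumes "\<And>p q. p \<noteq> q \<Longrightarrow> Z $ p $ q = 0"
    and comm: "\<And>i j a. a * Z $ j $ j = Z $ i $ i * a"
  shows "Z \<in> centre (**)"
proof -
  have 1: "(Z ** X) $ p $ q = Z $ p $ p * X $ p $ q" for X p q
  proof -
    have "(Z ** X) $ p $ q = (\<Sum>k\<in>UNIV. if k = p then Z $ p $ p * X $ p $ q else 0)"
      unfolding matrix_mult_nth by (rule sum.cong) (auto simp: assms(1))
    then show ?thesis by simp
  qed
  have 2: "(X ** Z) $ p $ q = X $ p $ q * Z $ q $ q" for X p q
  proof -
    have "(X ** Z) $ p $ q = (\<Sum>k\<in>UNIV. if k = q then X $ p $ q * Z $ q $ q else 0)"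
      unfolding matrix_mult_nth by (rule sum.cong) (auto simp: assms(1))
    then show ?thesis by simp
  qed
  show ?thesis unfolding centre_def by (simp add: vec_eq_iff 1 2 comm[symmetric])
qed

section \<open>Lie n-derivations and their values on diagonal idempotents\<close>

text \<open>
  The number of arguments is written \<open>m + 2\<close>, so that \<open>m\<close> counts the entries of the padding by \<open>e\<close>.
  The scalar action is kept apart: \<open>der_map_matrix\<close> carries linearity over to the derivation.
\<close>

locale matrix_lie_derivation = additive \<phi>
  for \<phi> :: "'a::ring_1^'s^'s \<Rightarrow> 'a^'s^'s" +
  fixes m :: nat
  assumes lie_poly: "\<phi> (lie_poly (**) (Suc (Suc m)) x)
    = (\<Sum>i=1..Suc (Suc m). lie_poly (**) (Suc (Suc m)) (x(i := \<phi> (x i))))"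
begin

lemma pad_eq:
  assumes "lie (lie u v) e = lie u v"
    and "lie (lie (lie u v) (\<phi> e)) e = lie (lie u v) (\<phi> e)"
  shows "\<phi> (lie u v) = ad_pow e m (lie (\<phi> u) v + lie u (\<phi> v)) + (\<Sum>_<m. lie (lie u v) (\<phi> e))"
proof -
  have "ad_pow e m (lie u v) = lie u v" using assms(1) by (induction m) auto
  then show ?thesis
    using lie_poly[of "pad u v e"] unfolding lie_poly_pad lie_poly_pad_sum[where f = \<phi>, OF assms] by simp
qed

text \<open>
  If \<open>u\<close> and \<open>v\<close> commute, every term with \<open>\<phi>\<close> in a later position is a bracket starting from \<open>[u, v] = 0\<close>,
  so only the terms with \<open>\<phi> u\<close> and \<open>\<phi> v\<close> are left.
\<close>

lemma pad_commuting:
  assumes "lie u v = 0"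
  shows "ad_pow e m (lie (\<phi> u) v + lie u (\<phi> v)) = 0"
  using pad_eq[of u v e] assms by (simp add: zero)

text \<open>
  The two values \<open>\<phi> e\<^sub>k\<close> and \<open>\<phi> e\<^sub>i\<close> are linked by \<open>[e\<^sub>k, e\<^sub>i] = 0\<close>. The resulting relations are
  exactly the compatibility conditions under which a single matrix \<open>M\<close> satisfies
  \<open>[e\<^sub>k, M] = \<phi> e\<^sub>k\<close> off the diagonal for all \<open>k\<close> at once.
\<close>

lemma idempotent_nth:
  assumes "i \<noteq> j" "k \<noteq> i"
  shows "\<phi> (E k k 1) $ i $ j = (if k = j then - \<phi> (E i i 1) $ i $ j else 0)"
proof -
  let ?Y = "lie (\<phi> (E k k 1)) (E i i 1) + lie (E k k 1) (\<phi> (E i i 1))"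
  have "ad_pow (E i i 1) m ?Y = 0"
    by (rule pad_commuting) (use assms in \<open>auto simp: lie_E_E\<close>)
  then have "(-1) ^ m * ?Y $ i $ j = 0"
    using ad_pow_row_nth[OF assms(1), of m ?Y] by simp
  then have "?Y $ i $ j = 0"
    by (cases "even m")
      (simp_all only: minus_one_power_iff if_True if_False mult_1_left mult_minus_left neg_equal_0_iff_equal)
  then show ?thesis
    using assms by (auto simp: lie_E_left_nth lie_E_right_nth minus_equation_iff)
qed

text \<open>
  Take \<open>E i k a\<close> as first argument and \<open>e\<^sub>k\<close> as all the others. Since \<open>\<phi> e\<^sub>k\<close> is diagonal, the bracket
  \<open>[E i k a, \<phi> e\<^sub>k]\<close> is again supported in entry \<open>(i, k)\<close>, and it occurs once for each of the \<open>m + 1\<close>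
  positions of \<open>e\<^sub>k\<close>. The remaining terms cancel in that entry. So \<open>a z\<^sub>k = z\<^sub>i a\<close> for the diagonal
  entries \<open>z\<close> of \<open>\<phi> e\<^sub>k\<close>, and \<open>a = 1\<close> makes them all equal.
\<close>

lemma idempotent_centre:
  assumes diag: "\<And>k p q. p \<noteq> q \<Longrightarrow> \<phi> (E k k 1) $ p $ q = 0"
    and torsion: "\<And>X :: 'a^'s^'s. (\<Sum>_<Suc m. X) = 0 \<Longrightarrow> X = 0"
    and two: "\<exists>i j :: 's. i \<noteq> j"
  shows "\<phi> (E k k 1) \<in> centre (**)"
proof -
  have comm: "a * \<phi> (E k k 1) $ k $ k = \<phi> (E k k 1) $ i $ i * a" if "i \<noteq> k" for i a
  proof -
    let ?u = "E i k a" and ?e = "E k k (1::'a)"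
    let ?X = "lie ?u (\<phi> ?e)"
    have u: "lie ?u ?e = ?u" using that by (simp add: lie_E_E)
    have X: "?X = E i k (a * \<phi> ?e $ k $ k - \<phi> ?e $ i $ i * a)"
      using that by (auto simp: vec_eq_iff lie_E_left_nth diag)
    have "\<phi> ?u = ad_pow ?e m (lie (\<phi> ?u) ?e + ?X) + (\<Sum>_<m. ?X)"
      using pad_eq[of ?u ?e ?e] that unfolding u X by (simp add: lie_E_E)
    then have "\<phi> ?u $ i $ k = (ad_pow ?e m (lie (\<phi> ?u) ?e + ?X) + (\<Sum>_<m. ?X)) $ i $ k"
      by simp
    \<comment> \<open>In entry \<open>(i, k)\<close> the first summand is \<open>\<phi> ?u $ i $ k + ?X $ i $ k\<close>, which cancels the left side.\<close>
    then have "0 = ?X $ i $ k + (\<Sum>_<m. ?X) $ i $ k"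
      using that by (simp add: ad_pow_col_nth lie_E_right_nth del: sum_constant)
    then have "(\<Sum>_<Suc m. ?X) $ i $ k = 0"
      by (simp add: add.commute del: sum_constant)
    moreover have "(\<Sum>_<Suc m. ?X) = E i k ((\<Sum>_<Suc m. ?X) $ i $ k)"
      unfolding X by (auto simp: vec_eq_iff)
    ultimately have "?X = 0" using torsion by (metis E_zero)
    then have "?X $ i $ k = 0" by simp
    then show ?thesis unfolding X by simp
  qed
  show ?thesis
  proof (rule scalar_in_centre[OF diag])
    fix i j :: 's and a
    let ?z = "\<lambda>i. \<phi> (E k k 1) $ i $ i"
    have eq: "?z p = ?z k" for p using comm[of p 1] by (cases "p = k") auto
    have "\<exists>p. p \<noteq> k" using two by metis
    then obtain p where "p \<noteq> k" by blast
    then have "a * ?z k = ?z k * a" using comm[of p a] eq[of p] by simp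
    then show "a * ?z j = ?z i * a" using eq[of i] eq[of j] by simp
  qed
qed

end

section \<open>Differences of Lie n-derivations and central values\<close>

lemma derivation_matrix_lie_derivation:
  assumes "\<And>X Y. d (X + Y) = d X + d Y"
    and prod: "\<And>X Y. d (X ** Y) = d X ** Y + X ** d Y"
  shows "matrix_lie_derivation d m"
proof -
  interpret additive d by unfold_locales (rule assms(1))
  show ?thesis
    by unfold_locales (rule lie_poly_derivation, simp add: lie_bracket_def diff prod)
qed

lemma matrix_lie_derivation_diff:
  assumes "matrix_lie_derivation f m" and "matrix_lie_derivation g m"
  shows "matrix_lie_derivation (\<lambda>X. f X - g X) m"
proof -
  interpret f: matrix_lie_derivation f m by fact
  interpret g: matrix_lie_derivation g m by fact
  show ?thesis
  proof
    fix x :: "nat \<Rightarrow> 'a^'b^'b"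
    have "lie_poly (**) (Suc (Suc m)) (x(i := f (x i) - g (x i)))
      = lie_poly (**) (Suc (Suc m)) (x(i := f (x i))) - lie_poly (**) (Suc (Suc m)) (x(i := g (x i)))"
      if "i \<in> {1..Suc (Suc m)}" for i
      using that by (rule lie_poly_update_diff)
    then show "f (lie_poly (**) (Suc (Suc m)) x) - g (lie_poly (**) (Suc (Suc m)) x)
      = (\<Sum>i=1..Suc (Suc m). lie_poly (**) (Suc (Suc m)) (x(i := f (x i) - g (x i))))"
      unfolding f.lie_poly g.lie_poly sum_subtractf[symmetric] by (intro sum.cong) auto
  qed (simp add: f.add g.add)
qed

lemma central_lie_derivation_lie_poly:
  assumes "matrix_lie_derivation t m" and "\<And>X. t X \<in> centre (**)"
  shows "t (lie_poly (**) (Suc (Suc m)) x) = 0"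
proof -
  interpret matrix_lie_derivation t m by fact
  have "lie_poly (**) (Suc (Suc m)) (x(i := t (x i))) = 0" if "i \<in> {1..Suc (Suc m)}" for i
    using that assms(2) by (intro lie_poly_centre[of i]) auto
  then show ?thesis unfolding lie_poly by (rule sum.neutral[OF ballI])
qed

lemma lie_right_derivation: "lie (X ** Y) M = lie X M ** Y + X ** lie Y M"
  by (simp add: lie_bracket_def matrix_sub_ldistrib matrix_sub_rdistrib matrix_mul_assoc)

section \<open>Lie n-derivations with central values on diagonal idempotents\<close>

locale normalised_matrix_lie_derivation = matrix_lie_derivation \<phi> m
  for \<phi> :: "'a::ring_1^'s^'s \<Rightarrow> 'a^'s^'s" and m +
  assumes idem: "\<phi> (E k k 1) \<in> centre (**)"
    and third: "\<exists>k :: 's. k \<noteq> i \<and> k \<noteq> j"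
begin

text \<open>
  Up to the operator \<open>ad_pow\<close>, which is harmless in the entries of interest, \<open>\<phi>\<close> behaves like an
  ordinary Lie derivation on such brackets.
\<close>

lemma bracket_fixed_by_idempotent:
  assumes "lie (lie u v) (E k k 1) = lie u v"
  shows "\<phi> (lie u v) = ad_pow (E k k 1) m (lie (\<phi> u) v + lie u (\<phi> v))"
proof -
  have "lie (lie u v) (\<phi> (E k k 1)) = 0" by (simp add: idem lie_centre)
  then show ?thesis using pad_eq[OF assms] by simp
qed

lemma off_diagonal_bracket:
  assumes "i \<noteq> j" and "lie u v = E i j a"
  shows "\<phi> (E i j a) = ad_pow (E j j 1) m (lie (\<phi> u) v + lie u (\<phi> v))"
  using bracket_fixed_by_idempotent[of u v j] assms by (simp add: lie_E_E)

lemma off_diagonal_bracket_nth: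
  assumes "i \<noteq> j" and "lie u v = E i j a"
  shows "\<phi> (E i j a) $ i $ j = (lie (\<phi> u) v + lie u (\<phi> v)) $ i $ j"
  unfolding off_diagonal_bracket[OF assms] by (rule ad_pow_col_nth[OF assms(1)])

text \<open>
  Bracketing \<open>E i j a\<close> with \<open>e\<^sub>j\<close> and with \<open>e\<^sub>i\<close> confines its image to the entries with exactly one index
  equal to \<open>j\<close>, respectively \<open>i\<close>. The entry \<open>(j, i)\<close> survives: an odd number \<open>n\<close> of arguments
  allows an even number of brackets with diagonal units only, and these do not separate it from \<open>(i, j)\<close>.
\<close>

lemma off_diagonal_symmetric_support:
  assumes "i \<noteq> j" and "(p, q) \<noteq> (i, j)" and "(p, q) \<noteq> (j, i)"
  shows "\<phi> (E i j a) $ p $ q = 0"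
proof -
  let ?u = "E i j a"
  have 1: "\<phi> ?u = ad_pow (E j j 1) m (lie (\<phi> ?u) (E j j 1))"
    using off_diagonal_bracket[of i j ?u "E j j 1" a] assms(1)
    by (simp add: lie_E_E lie_centre idem)
  have 2: "\<phi> ?u = ad_pow (E j j 1) m (lie (E i i 1) (\<phi> ?u))"
    using off_diagonal_bracket[of i j "E i i 1" ?u a] assms(1)
    by (simp add: lie_E_E lie_centre idem)
  have "\<phi> ?u $ p $ q = 0" if "p = q \<or> p \<noteq> j \<and> q \<noteq> j"
    by (subst 1, rule ad_pow_nth_zero) (use that in \<open>auto simp: lie_E_right_nth\<close>)
  moreover have "\<phi> ?u $ p $ q = 0" if "p = q \<or> p \<noteq> i \<and> q \<noteq> i"
    by (subst 2, rule ad_pow_nth_zero) (use that in \<open>auto simp: lie_E_left_nth\<close>)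
  ultimately show ?thesis using assms by blast
qed

text \<open>
  A third index \<open>k\<close> writes \<open>E i j a\<close> as the bracket of \<open>E i k a\<close> and \<open>E k j 1\<close>. The transposed entries
  \<open>(k, i)\<close> and \<open>(j, k)\<close> that the images of the two factors may still have contribute nothing to the
  bracket, since no path through them composes with the other factor.
\<close>

lemma off_diagonal_support:
  assumes "i \<noteq> j" and "(p, q) \<noteq> (i, j)"
  shows "\<phi> (E i j a) $ p $ q = 0"
proof -
  obtain k where k: "k \<noteq> i" "k \<noteq> j" using third by blast
  have uv: "lie (E i k a) (E k j 1) = E i j a" using assms(1) k by (simp add: lie_E_E)
  show ?thesis
    unfolding off_diagonal_bracket[OF assms(1) uv]
    by (rule ad_pow_nth_zero)
      (use assms k in \<open>auto simp: lie_E_right_nth lie_E_left_nth off_diagonal_symmetric_support\<close>)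
qed

lemma off_diagonal_product:
  assumes "i \<noteq> j" "i \<noteq> k" "k \<noteq> j"
  shows "\<phi> (E i j (a * b)) $ i $ j = \<phi> (E i k a) $ i $ k * b + a * \<phi> (E k j b) $ k $ j"
proof -
  have "lie (E i k a) (E k j b) = E i j (a * b)" using assms by (simp add: lie_E_E)
  from off_diagonal_bracket_nth[OF assms(1) this] show ?thesis
    using assms by (simp add: lie_E_right_nth lie_E_left_nth)
qed

text \<open>
  The matrix \<open>E i i a\<close> commutes with all \<open>e\<^sub>p\<close>, and \<open>ad_pow\<close> loses nothing off the diagonal, so its image
  commutes with all \<open>e\<^sub>p\<close> as well: it is diagonal.
\<close>

lemma diagonal_support:
  assumes "p \<noteq> q"
  shows "\<phi> (E i i a) $ p $ q = 0"
proof -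
  have "ad_pow (E p p 1) m (lie (\<phi> (E i i a)) (E p p 1)) = 0"
    using pad_commuting[of "E i i a" "E p p 1" "E p p 1"] by (auto simp: lie_E_E idem lie_centre)
  then have "(-1) ^ m * \<phi> (E i i a) $ p $ q = 0"
    using ad_pow_row_nth[OF assms, of m "lie (\<phi> (E i i a)) (E p p 1)"] assms
    by (simp add: lie_E_right_nth)
  then show ?thesis by (cases "even m") simp_all
qed

lemma diagonal_product_left:
  assumes "i \<noteq> j"
  shows "\<phi> (E i j (a * b)) $ i $ j
    = \<phi> (E i i a) $ i $ i * b - b * \<phi> (E i i a) $ j $ j + a * \<phi> (E i j b) $ i $ j"
proof -
  have "lie (E i i a) (E i j b) = E i j (a * b)" using assms by (simp add: lie_E_E)
  from off_diagonal_bracket_nth[OF assms this] show ?thesis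
    using assms by (simp add: lie_E_right_nth lie_E_left_nth)
qed

lemma diagonal_product_right:
  assumes "j \<noteq> i"
  shows "\<phi> (E j i (b * a)) $ j $ i
    = \<phi> (E j i b) $ j $ i * a + (b * \<phi> (E i i a) $ i $ i - \<phi> (E i i a) $ j $ j * b)"
proof -
  have "lie (E j i b) (E i i a) = E j i (b * a)" using assms by (simp add: lie_E_E)
  from off_diagonal_bracket_nth[OF assms this] show ?thesis
    using assms by (simp add: lie_E_right_nth lie_E_left_nth)
qed

text \<open>
  For distinct \<open>i, j, k\<close> this expresses that \<open>E i i a\<close> commutes with \<open>E j k b\<close>. With \<open>b = 1\<close> it shows that the
  diagonal entries other than the one at \<open>i\<close> agree, and then the case \<open>j = k\<close> follows: these entries
  are central in the coefficient ring.
\<close>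

lemma diagonal_other_entries:
  assumes "i \<noteq> j" "i \<noteq> k"
  shows "b * \<phi> (E i i a) $ k $ k = \<phi> (E i i a) $ j $ j * b"
proof -
  have *: "b * \<phi> (E i i a) $ k $ k = \<phi> (E i i a) $ j $ j * b"
    if "i \<noteq> j" "i \<noteq> k" "j \<noteq> k" for j k b
  proof -
    have "lie (E i i a) (E j k b) = 0" using that by (simp add: lie_E_E)
    from pad_commuting[OF this, of "E k k 1"] ad_pow_col_nth[OF that(3), of m
        "lie (\<phi> (E i i a)) (E j k b) + lie (E i i a) (\<phi> (E j k b))"]
    show ?thesis
      using that by (simp add: lie_E_right_nth lie_E_left_nth)
  qed
  show ?thesis
  proof (cases "j = k")
    case True
    obtain l where l: "l \<noteq> i" "l \<noteq> k" using third by blast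
    have "\<phi> (E i i a) $ k $ k = \<phi> (E i i a) $ l $ l"
      using *[of l k 1] l assms by simp
    then show ?thesis using *[of l k b] l assms True by simp
  next
    case False
    then show ?thesis using * assms by blast
  qed
qed

text \<open>
  The common diagonal entry of \<open>\<phi> (E i i a)\<close> outside position \<open>i\<close>; the choice of the position \<open>j\<close> is immaterial
  by \<open>diagonal_other_entries\<close>. The name comes from the commutative case, where the prototype of a
  central-valued map killing brackets is the trace times the identity.
\<close>

definition trace_part :: "'s \<Rightarrow> 'a \<Rightarrow> 'a"
  where "trace_part i a = \<phi> (E i i a) $ (SOME j. j \<noteq> i) $ (SOME j. j \<noteq> i)"

lemma trace_part_nth: "j \<noteq> i \<Longrightarrow> \<phi> (E i i a) $ j $ j = trace_part i a"
  using diagonal_other_entries[of i j "SOME j. j \<noteq> i" 1 a] someI[of "\<lambda>j. j \<noteq> i" j]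
  by (simp add: trace_part_def)

lemma trace_part_commute: "b * trace_part i a = trace_part i a * b"
proof -
  obtain j where "j \<noteq> i" using third by blast
  then show ?thesis using diagonal_other_entries[of i j j b a] trace_part_nth[of j i a] by simp
qed

definition coeff :: "'s \<Rightarrow> 's \<Rightarrow> 'a \<Rightarrow> 'a"
  where "coeff i j a = \<phi> (E i j a) $ i $ j - (if i = j then trace_part i a else 0)"

lemma coeff_add: "coeff i j (a + b) = coeff i j a + coeff i j b"
  by (simp add: coeff_def trace_part_def E_add add)

lemma coeff_sum: "coeff i j (\<Sum>k\<in>K. f k) = (\<Sum>k\<in>K. coeff i j (f k))"
  by (rule additive.sum) (simp add: additive_def coeff_add)

text \<open>
  The Leibniz rule for \<open>der\<close>, one entry at a time. It comes directly from brackets when \<open>i \<noteq> j\<close>; there,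
  subtracting the central \<open>trace_part\<close> turns the commutator-like expressions of \<open>diagonal_product_left\<close> and
  \<open>diagonal_product_right\<close> into genuine products. For \<open>i = j\<close>, multiply by a unit in entry \<open>(i, l)\<close> with
  \<open>l \<noteq> i, k\<close>, compute \<open>coeff i l\<close> of the triple product with both bracketings, and compare.
\<close>

lemma coeff_product: "coeff i j (a * b) = coeff i k a * b + a * coeff k j b"
proof -
  have left: "coeff i j (a * b) = coeff i i a * b + a * coeff i j b" if "i \<noteq> j" for i j a b
    using diagonal_product_left[OF that, of a b] trace_part_nth[of j i a] that
    by (simp add: coeff_def trace_part_commute algebra_simps)
  have right: "coeff j i (b * a) = coeff j i b * a + b * coeff i i a" if "j \<noteq> i" for i j a b
    using diagonal_product_right[OF that, of b a] trace_part_nth[of j i a] that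
    by (simp add: coeff_def trace_part_commute algebra_simps)
  have distinct: "coeff i j (a * b) = coeff i k a * b + a * coeff k j b"
    if "i \<noteq> j" "i \<noteq> k" "k \<noteq> j" for i j k a b
    using off_diagonal_product[OF that, of a b] that by (simp add: coeff_def)
  consider "i = j" "k = i" | "i = j" "k \<noteq> i" | "i \<noteq> j" "k = i" | "i \<noteq> j" "k = j"
    | "i \<noteq> j" "i \<noteq> k" "k \<noteq> j" by blast
  then show ?thesis
  proof cases
    case 1
    obtain l where l: "i \<noteq> l" using third by metis
    have "coeff i i (a * b) * 1 + a * b * coeff i l 1 = coeff i l (a * (b * 1))"
      using left[OF l, of "a * b" 1] by (simp add: mult.assoc)
    also have "\<dots> = coeff i i a * b + a * (coeff i i b * 1 + b * coeff i l 1)"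
      using left[OF l, of a "b * 1"] left[OF l, of b 1] by simp
    finally show ?thesis using 1 by (simp add: algebra_simps)
  next
    case 2
    obtain l where l: "i \<noteq> l" "k \<noteq> l" using third by metis
    have "coeff i i (a * b) * 1 + a * b * coeff i l 1 = coeff i l (a * (b * 1))"
      using left[OF l(1), of "a * b" 1] by (simp add: mult.assoc)
    also have "\<dots> = coeff i k a * b + a * (coeff k i b * 1 + b * coeff i l 1)"
      using distinct[of i l k a "b * 1"] distinct[of k l i b 1] l 2 by simp
    finally show ?thesis using 2 by (simp add: algebra_simps)
  next
    case 3
    then show ?thesis using left by simp
  next
    case 4
    then show ?thesis using right by simp
  next
    case 5
    then show ?thesis using distinct by blast
  qed
qed

definition der :: "'a^'s^'s \<Rightarrow> 'a^'s^'s"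
  where "der X = (\<chi> i j. coeff i j (X $ i $ j))"

lemma der_product: "der (X ** Y) = der X ** Y + X ** der Y"
proof -
  have "coeff i j (X $ i $ k * Y $ k $ j) = coeff i k (X $ i $ k) * Y $ k $ j + X $ i $ k * coeff k j (Y $ k $ j)"
    for i j k by (rule coeff_product)
  then show ?thesis
    by (simp add: vec_eq_iff der_def matrix_mult_nth coeff_sum sum.distrib)
qed

lemma der_add: "der (X + Y) = der X + der Y"
  by (simp add: vec_eq_iff der_def coeff_add)

text \<open>
  For \<open>s\<close> the multiplication by a scalar, this transports linearity from \<open>\<phi>\<close> to \<open>der\<close>.
\<close>

lemma der_map_matrix:
  assumes "additive s" and "\<And>X. \<phi> (map_matrix s X) = map_matrix s (\<phi> X)"
  shows "der (map_matrix s X) = map_matrix s (der X)"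
proof -
  interpret s: additive s by fact
  have "E i j (s a) = map_matrix s (E i j a)" for i j :: 's and a
    by (simp add: vec_eq_iff map_matrix_def s.zero)
  then have unit: "\<phi> (E i j (s a)) = map_matrix s (\<phi> (E i j a))" for i j a
    by (simp only: assms(2))
  have "coeff i j (s a) = s (coeff i j a)" for i j a
    by (simp add: coeff_def trace_part_def unit s.diff s.zero)
  then show ?thesis by (simp add: vec_eq_iff der_def map_matrix_def)
qed

lemma minus_der_unit_centre: "\<phi> (E i j a) - der (E i j a) \<in> centre (**)"
proof (cases "i = j")
  case True
  have "coeff p q 0 = 0" for p q using coeff_add[of p q 0 0] by simp
  moreover obtain k where "k \<noteq> i" using third by blast
  ultimately show ?thesis
    by (intro scalar_in_centre)
      (auto simp: der_def diagonal_support trace_part_nth trace_part_commute coeff_def True)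
next
  case False
  have "coeff p q 0 = 0" for p q using coeff_add[of p q 0 0] by simp
  then have "\<phi> (E i j a) - der (E i j a) = 0"
    using False by (auto simp: vec_eq_iff der_def off_diagonal_support coeff_def)
  then show ?thesis by (simp add: centre_def)
qed

lemma minus_der_centre: "\<phi> X - der X \<in> centre (**)"
proof -
  let ?t = "\<lambda>X. \<phi> X - der X"
  interpret t: additive ?t by unfold_locales (simp add: add der_add)
  have sum: "(\<Sum>i\<in>I. f i) \<in> centre (**)" if "\<And>i. f i \<in> centre (**)" for I :: "'s set" and f :: "'s \<Rightarrow> 'a^'s^'s"
    using that
    by (induction I rule: infinite_finite_induct)
      (auto simp: centre_def matrix_add_ldistrib matrix_add_rdistrib)
  have "?t X = ?t (\<Sum>i\<in>UNIV. \<Sum>j\<in>UNIV. E i j (X $ i $ j))"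
    by (simp only: E_sum[symmetric])
  also have "\<dots> = (\<Sum>i\<in>UNIV. \<Sum>j\<in>UNIV. ?t (E i j (X $ i $ j)))"
    by (simp only: t.sum)
  also have "\<dots> \<in> centre (**)"
    by (intro sum minus_der_unit_centre)
  finally show ?thesis .
qed

end

section \<open>Lie n-derivations of matrix algebras are standard\<close>

theorem corollary3p4:
  fixes smul :: "'r::comm_ring_1 \<Rightarrow> 'a::ring_1 \<Rightarrow> 'a"
    and n :: nat
    and \<phi> :: "'a^'s^'s \<Rightarrow> 'a^'s^'s"
  assumes "n \<ge> 2"
    and "CARD('s::finite) \<ge> 3"
    and "unital_algebra smul"
    and "torsion_free 2 (UNIV :: ('a^'s^'s) set)"
    and "torsion_free (n - 1) (UNIV :: ('a^'s^'s) set)"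
    and "lie_n_derivation (mat_smul smul) (**) n \<phi>"
  shows "standard_lie_n_derivation (mat_smul smul) (**) n \<phi>"
proof -
  obtain m where n: "n = Suc (Suc m)"
    using \<open>n \<ge> 2\<close> by (metis Suc_le_D numeral_2_eq_2 Suc_le_mono)
  interpret unital_algebra smul by fact
  interpret S: module "mat_smul smul :: 'r \<Rightarrow> 'a^'s^'s \<Rightarrow> 'a^'s^'s" by (rule module_mat_smul)
  interpret \<phi>: module_hom "mat_smul smul" "mat_smul smul" \<phi>
    using assms(6) by (simp add: lie_n_derivation_def)
  interpret L: matrix_lie_derivation \<phi> m
    using assms(6) by unfold_locales (simp_all add: \<phi>.add lie_n_derivation_def n)
  have third: "\<exists>k :: 's. k \<noteq> i \<and> k \<noteq> j" for i j
  proof (rule ccontr)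
    assume "\<not> ?thesis"
    then have "UNIV \<subseteq> {i, j}" by auto
    then have "CARD('s) \<le> card {i, j}" by (intro card_mono) auto
    also have "\<dots> \<le> 2" by (simp add: card_insert_if)
    finally show False using assms(2) by simp
  qed
  \<comment> \<open>Chosen such that \<open>[e\<^sub>k, M]\<close> is the off-diagonal part of \<open>\<phi> e\<^sub>k\<close> for every \<open>k\<close>.\<close>
  define M :: "'a^'s^'s" where "M = (\<chi> p q. if p = q then 0 else \<phi> (E p p 1) $ p $ q)"
  define D where "D X = lie X M" for X
  define \<psi> where "\<psi> X = \<phi> X - D X" for X
  have D_add: "D (X + Y) = D X + D Y" for X Y
    by (simp add: D_def lie_add_left)
  have D_product: "D (X ** Y) = D X ** Y + X ** D Y" for X Y
    by (simp add: D_def lie_right_derivation)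
  have D_scale: "D (mat_smul smul r X) = mat_smul smul r (D X)" for r X
    by (simp add: D_def lie_bracket_def mat_smul_def map_matrix_def vec_eq_iff matrix_mult_nth
        smul_mult_left smul_mult_right scale_sum_right scale_right_diff_distrib)
  have \<psi>: "matrix_lie_derivation \<psi> m"
    unfolding \<psi>_def
    by (rule matrix_lie_derivation_diff[OF L.matrix_lie_derivation_axioms
          derivation_matrix_lie_derivation[OF D_add D_product]])
  then interpret P: matrix_lie_derivation \<psi> m .
  have idem: "\<psi> (E k k 1) \<in> centre (**)" for k
  proof (rule P.idempotent_centre)
    fix k p q :: 's assume "p \<noteq> q"
    then show "\<psi> (E k k 1) $ p $ q = 0"
      using L.idempotent_nth[of p q k]
      by (auto simp: \<psi>_def D_def M_def lie_E_left_nth)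
  next
    fix X :: "'a^'s^'s" assume "(\<Sum>_<Suc m. X) = 0"
    then show "X = 0" using assms(5) unfolding torsion_free_def n by (metis UNIV_I diff_Suc_1)
  next
    show "\<exists>i j :: 's. i \<noteq> j" using third by metis
  qed
  interpret N: normalised_matrix_lie_derivation \<psi> m
    by unfold_locales (fact idem third)+
  have \<psi>_scale: "\<psi> (mat_smul smul r X) = mat_smul smul r (\<psi> X)" for r X
    by (simp add: \<psi>_def \<phi>.scale D_scale S.scale_right_diff_distrib)
  have der_scale: "N.der (mat_smul smul r X) = mat_smul smul r (N.der X)" for r X
    unfolding mat_smul_def
  proof (rule N.der_map_matrix)
    show "additive (smul r)" by unfold_locales (rule scale_right_distrib)
    show "\<psi> (map_matrix (smul r) X) = map_matrix (smul r) (\<psi> X)" for X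
      using \<psi>_scale by (simp add: mat_smul_def)
  qed
  let ?h = "\<lambda>X. N.der X + D X" and ?\<tau> = "\<lambda>X. \<psi> X - N.der X"
  have "algebra_derivation (mat_smul smul) (**) ?h"
    unfolding algebra_derivation_def
  proof (intro conjI allI)
    show "module_hom (mat_smul smul) (mat_smul smul) ?h"
      by unfold_locales
        (simp_all add: N.der_add D_add der_scale D_scale S.scale_right_distrib)
    show "?h (X ** Y) = ?h X ** Y + X ** ?h Y" for X Y
      by (simp add: N.der_product D_product matrix_add_ldistrib matrix_add_rdistrib)
  qed
  moreover have "module_hom (mat_smul smul) (mat_smul smul) ?\<tau>"
    by unfold_locales
      (simp_all add: N.der_add P.add der_scale \<psi>_scale S.scale_right_diff_distrib)
  moreover have "range ?\<tau> \<subseteq> centre (**)"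
    using N.minus_der_centre by auto
  moreover have "?\<tau> (lie_poly (**) n X) = 0" for X
    unfolding n
    by (rule central_lie_derivation_lie_poly[OF matrix_lie_derivation_diff[OF \<psi>
          derivation_matrix_lie_derivation[OF N.der_add N.der_product]] N.minus_der_centre])
  moreover have "\<phi> = (\<lambda>X. ?h X + ?\<tau> X)"
    by (simp add: \<psi>_def)
  ultimately have "\<exists>h \<tau>. \<phi> = (\<lambda>X. h X + \<tau> X) \<and> algebra_derivation (mat_smul smul) (**) h \<and>
      module_hom (mat_smul smul) (mat_smul smul) \<tau> \<and> range \<tau> \<subseteq> centre (**) \<and>
      (\<forall>x. \<tau> (lie_poly (**) n x) = 0)"
    by (intro exI[of _ ?h] exI[of _ ?\<tau>] conjI allI)
  with assms(6) show ?thesis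
    unfolding standard_lie_n_derivation_def by (rule conjI)
qed

end
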